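(* Let $g\ge0$ be an integer. Every primitive partition of genus $g$ is a partition of a set $\{1,\ldots,n\}$ with at most $6(2g-1)$ elements. Moreover, for any $g$ there is a finite number of semiprimitive partitions of genus $g$, hence also a finite number of primitive ones.
   Context: For $n\ge1$ let $\zeta_n=(1,2,\ldots,n)$; additions $i+1$ are modulo $n$, i.e. $i+1$ means $\zeta_n(i)$. Let $z(\cdot)$ be the number of cycles of a permutation (fixed points included); products are composed right to left. The genus $g(\alpha)$ of a permutation $\alpha$ of $\{1,\ldots,n\}$, $n\ge 1$, is the nonnegative integer defined by $n+1-2g(\alpha)=z(\alpha)+z(\alpha^{-1}\zeta_n)$. A permutation $\alpha$ of $\{1,\ldots,n\}$ is a partition if each of its cycles, listed beginning with its least element, is an increasing list. A permutation $\alpha$ is reduced if neither $\alpha$ nor $\alpha^{-1}\zeta_n$ has a fixed point (i.e. there is no $i$ with $\alpha(i)=i$ or $\alpha(i)=i+1$). For a reduced permutation $\alpha$ and a pair $\{i,j\}\subseteq\{1,\ldots,n\}$ with $\alpha(i)=j+1$ and $\alpha(j)=i+1$, the directed edges $i\to\alpha(i)$ and $j\to\alpha(j)$ are called parallel edges. A reduced partition $\alpha$ is semiprimitive if it has no pair of parallel edges $\{i\to\alpha(i),\,j\to\alpha(j)\}$ such that $(i,\alpha(i))$ is a $2$-cycle of $\alpha$; it is primitive if it has no pair of parallel edges at all. *)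

theory Defs
  imports "HOL-Combinatorics.Cycles" "HOL-Combinatorics.Orbits"
begin

text \<open>
  A permutation of \<open>{1, \<dots>, n}\<close> is a function \<open>\<alpha> :: nat \<Rightarrow> nat\<close> with \<open>\<alpha> permutes {1..n}\<close>;
  it is the identity outside \<open>{1..n}\<close>, so \<open>n\<close> is always passed along with \<open>\<alpha>\<close>.
\<close>

definition zeta :: "nat \<Rightarrow> nat \<Rightarrow> nat" where
  "zeta n = cycle_of_list [1..<Suc n]"

lemma zeta_apply:
  assumes "i \<in> {1..n}"
  shows "zeta n i = (if i = n then 1 else i + 1)"
proof -
  have "map (zeta n) [1..<Suc n] = rotate1 [1..<Suc n]"
    using cyclic_rotation[of "[1..<Suc n]" 1] by (simp add: zeta_def)
  moreover have "rotate1 [1..<Suc n] = [2..<Suc n] @ [1]"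
    using assms by (simp add: upt_conv_Cons numeral_2_eq_2 del: upt_Suc)
  ultimately have eq: "map (zeta n) [1..<Suc n] = [2..<Suc n] @ [1]"
    by simp
  have "zeta n i = map (zeta n) [1..<Suc n] ! (i - 1)"
    using assms by (subst nth_map) (auto simp: nth_upt simp del: upt_Suc)
  also have "\<dots> = ([2..<Suc n] @ [1]) ! (i - 1)"
    by (simp only: eq)
  also have "\<dots> = (if i = n then 1 else i + 1)"
    using assms by (auto simp: nth_append simp del: upt_Suc)
  finally show ?thesis .
qed

definition num_cycles :: "nat \<Rightarrow> (nat \<Rightarrow> nat) \<Rightarrow> nat" where
  "num_cycles n \<alpha> = card (orbit \<alpha> ` {1..n})"

text \<open>
  \<open>has_genus n \<alpha> g\<close> says that \<open>g\<close> is the genus of the permutation \<open>\<alpha>\<close> of \<open>{1..n}\<close>: the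
  nonnegative integer solving the defining equation. For given \<open>n\<close> and \<open>\<alpha>\<close>
  that equation has at most one solution \<open>g\<close>.
\<close>

definition has_genus :: "nat \<Rightarrow> (nat \<Rightarrow> nat) \<Rightarrow> nat \<Rightarrow> bool" where
  "has_genus n \<alpha> g \<longleftrightarrow> 1 \<le> n \<and> \<alpha> permutes {1..n} \<and>
     int n + 1 - 2 * int g = int (num_cycles n \<alpha>) + int (num_cycles n (inv \<alpha> \<circ> zeta n))"

lemma has_genus_unique: "has_genus n \<alpha> g \<Longrightarrow> has_genus n \<alpha> g' \<Longrightarrow> g = g'"
  by (simp add: has_genus_def)

text \<open>
  \<open>support \<alpha> m = [m, \<alpha> m, \<alpha> (\<alpha> m), \<dots>]\<close> lists the cycle of \<open>\<alpha>\<close> through \<open>m\<close>, beginning with \<open>m\<close>.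
\<close>

definition is_partition :: "nat \<Rightarrow> (nat \<Rightarrow> nat) \<Rightarrow> bool" where
  "is_partition n \<alpha> \<longleftrightarrow> 1 \<le> n \<and> \<alpha> permutes {1..n} \<and>
     (\<forall>i\<in>{1..n}. sorted_wrt (<) (support \<alpha> (Min (orbit \<alpha> i))))"

definition reduced :: "nat \<Rightarrow> (nat \<Rightarrow> nat) \<Rightarrow> bool" where
  "reduced n \<alpha> \<longleftrightarrow> 1 \<le> n \<and> \<alpha> permutes {1..n} \<and>
     (\<forall>i\<in>{1..n}. \<alpha> i \<noteq> i) \<and> (\<forall>i\<in>{1..n}. (inv \<alpha> \<circ> zeta n) i \<noteq> i)"

definition parallel_edges :: "nat \<Rightarrow> (nat \<Rightarrow> nat) \<Rightarrow> nat \<Rightarrow> nat \<Rightarrow> bool" where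
  "parallel_edges n \<alpha> i j \<longleftrightarrow> i \<in> {1..n} \<and> j \<in> {1..n} \<and> i \<noteq> j \<and>
     \<alpha> i = zeta n j \<and> \<alpha> j = zeta n i"

text \<open>
  Since \<open>parallel_edges n \<alpha>\<close> is symmetric, quantifying over ordered pairs covers the case that
  either of the two parallel edges lies on a 2-cycle.
\<close>

definition semiprimitive :: "nat \<Rightarrow> (nat \<Rightarrow> nat) \<Rightarrow> bool" where
  "semiprimitive n \<alpha> \<longleftrightarrow> is_partition n \<alpha> \<and> reduced n \<alpha> \<and>
     \<not> (\<exists>i j. parallel_edges n \<alpha> i j \<and> \<alpha> i \<noteq> i \<and> \<alpha> (\<alpha> i) = i)"

definition primitive :: "nat \<Rightarrow> (nat \<Rightarrow> nat) \<Rightarrow> bool" where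
  "primitive n \<alpha> \<longleftrightarrow> is_partition n \<alpha> \<and> reduced n \<alpha> \<and> \<not> (\<exists>i j. parallel_edges n \<alpha> i j)"

end

theory Submission
  imports Defs
begin

text \<open>
  The permutation \<open>\<beta> = \<alpha>\<^sup>-\<^sup>1 \<zeta>\<^sub>n\<close> satisfies \<open>\<beta> i = j\<close> iff \<open>\<alpha> j = i + 1\<close>, so pairs of parallel
  edges of \<open>\<alpha>\<close> are precisely the 2-cycles of \<open>\<beta>\<close>. Hence \<open>\<alpha>\<close> is semiprimitive only if \<open>\<alpha>\<close> and \<open>\<beta>\<close>
  have no fixed points and no element lies both on a 2-cycle of \<open>\<alpha>\<close> and on a 2-cycle of \<open>\<beta>\<close>.
  A fixed-point free permutation with \<open>t\<close> elements on 2-cycles has at most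
  \<open>t/2 + (n - t)/3 = n/3 + t/6\<close> cycles, so \<open>n + 1 - 2g \<le> 2n/3 + n/6\<close>, i.e. \<open>n \<le> 6(2g - 1)\<close>. The
  bound therefore holds for semiprimitive partitions already, and finiteness follows.
\<close>

lemma orbit_apply_eq:
  assumes "permutation f"
  shows "orbit f (f x) = orbit f x"
  using orbit_cyclic_eq3[OF cyclic_on_orbit'[OF assms] orbit.base] .

text \<open>Discharging: points carry weights such that each cycle weighs at least 6, and the total
  weight is the right-hand side. The factor 6 clears the denominators of n/3 + t/6.\<close>

lemma six_num_cycles_le:
  assumes perm: "\<sigma> permutes {1..n}"
    and fixfree: "\<And>i. i \<in> {1..n} \<Longrightarrow> \<sigma> i \<noteq> i"
  shows "6 * num_cycles n \<sigma> \<le> 2 * n + card {i \<in> {1..n}. \<sigma> (\<sigma> i) = i}"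
proof -
  \<comment> \<open>Weight 3 on 2-cycles and 2 elsewhere: a 2-cycle weighs 3 + 3, a longer cycle at
    least 2 + 2 + 2.\<close>
  define h where "h i = 2 + (if \<sigma> (\<sigma> i) = i then 1 else 0 :: nat)" for i
  have p: "permutation \<sigma>"
    using perm permutation_permutes by blast
  have fibre: "6 \<le> sum h {j \<in> {1..n}. orbit \<sigma> j = orbit \<sigma> i}" (is "6 \<le> sum h ?F")
    if i: "i \<in> {1..n}" for i
  proof -
    have in_F: "i \<in> ?F" "\<sigma> i \<in> ?F" "\<sigma> (\<sigma> i) \<in> ?F"
      using i permutes_in_image[OF perm] by (simp_all add: orbit_apply_eq[OF p])
    have ne: "\<sigma> i \<noteq> i" "\<sigma> (\<sigma> i) \<noteq> \<sigma> i"
      using in_F fixfree by auto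
    show ?thesis
    proof (cases "\<sigma> (\<sigma> i) = i")
      case True
      then have "6 = sum h {i, \<sigma> i}"
        using ne by (simp add: h_def)
      also have "\<dots> \<le> sum h ?F"
        using in_F by (intro sum_mono2) auto
      finally show ?thesis .
    next
      case False
      then have "6 \<le> sum h {i, \<sigma> i, \<sigma> (\<sigma> i)}"
        using ne by (simp add: h_def)
      also have "\<dots> \<le> sum h ?F"
        using in_F by (intro sum_mono2) auto
      finally show ?thesis .
    qed
  qed
  have "6 * num_cycles n \<sigma> = (\<Sum>C\<in>orbit \<sigma> ` {1..n}. 6)"
    by (simp add: num_cycles_def)
  also have "\<dots> \<le> (\<Sum>C\<in>orbit \<sigma> ` {1..n}. sum h {j \<in> {1..n}. orbit \<sigma> j = C})"
    using fibre by (intro sum_mono) blast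
  also have "\<dots> = sum h {1..n}"
    by (rule sum.image_gen[symmetric]) simp
  also have "\<dots> = 2 * n + card {i \<in> {1..n}. \<sigma> (\<sigma> i) = i}"
    unfolding h_def sum.distrib by (simp flip: sum.inter_filter)
  finally show ?thesis .
qed

lemma zeta_permutes: "zeta n permutes {1..n}"
  using cycle_permutes[of "[1..<Suc n]"]
  by (simp add: zeta_def atLeastLessThanSuc_atLeastAtMost del: upt_Suc)

lemma parallel_edges_iff_two_cycle:
  assumes "\<alpha> permutes {1..n}"
  defines "\<beta> \<equiv> inv \<alpha> \<circ> zeta n"
  shows "parallel_edges n \<alpha> i j \<longleftrightarrow> i \<in> {1..n} \<and> \<beta> i \<noteq> i \<and> \<beta> i = j \<and> \<beta> (\<beta> i) = i"
proof -
  have "\<beta> permutes {1..n}"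
    unfolding \<beta>_def using assms(1) zeta_permutes by (intro permutes_compose permutes_inv)
  \<comment> \<open>Turns the two edge equations into \<open>\<beta> j = i\<close> and
    \<open>\<beta> i = j\<close>.\<close>
  moreover have "\<alpha> k = zeta n l \<longleftrightarrow> \<beta> l = k" for k l
    unfolding \<beta>_def by (auto simp: permutes_inv_eq[OF assms(1)])
  ultimately show ?thesis
    using permutes_in_image[of \<beta> "{1..n}" i] unfolding parallel_edges_def by auto
qed

text \<open>Stated over the integers so that g = 0, where the right-hand side is -6, excludes every
  n.\<close>

lemma semiprimitive_genus_bound:
  assumes semi: "semiprimitive n \<alpha>" and genus: "has_genus n \<alpha> g"
  shows "int n \<le> 6 * (2 * int g - 1)"
proof -
  define \<beta> where "\<beta> = inv \<alpha> \<circ> zeta n"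
  define A where "A = {i \<in> {1..n}. \<alpha> (\<alpha> i) = i}"
  define B where "B = {i \<in> {1..n}. \<beta> (\<beta> i) = i}"
  have a: "\<alpha> permutes {1..n}" and fix_a: "\<And>i. i \<in> {1..n} \<Longrightarrow> \<alpha> i \<noteq> i"
    and fix_b: "\<And>i. i \<in> {1..n} \<Longrightarrow> \<beta> i \<noteq> i"
    using semi unfolding semiprimitive_def reduced_def \<beta>_def by blast+
  have b: "\<beta> permutes {1..n}"
    unfolding \<beta>_def using a zeta_permutes by (intro permutes_compose permutes_inv)
  \<comment> \<open>The edges leaving \<open>i\<close> and \<open>\<beta> i\<close> are parallel, so
    the one at \<open>i\<close> cannot lie on a 2-cycle of \<alpha>.\<close>
  have "\<alpha> (\<alpha> i) \<noteq> i" if "i \<in> B" for i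
  proof -
    have "parallel_edges n \<alpha> i (\<beta> i)"
      using that fix_b parallel_edges_iff_two_cycle[OF a] unfolding B_def \<beta>_def by blast
    then show ?thesis
      using semi that fix_a unfolding semiprimitive_def B_def by blast
  qed
  then have "A \<inter> B = {}"
    unfolding A_def by blast
  then have "card A + card B = card (A \<union> B)"
    by (simp add: card_Un_disjoint A_def B_def)
  also have "\<dots> \<le> card {1..n}"
    unfolding A_def B_def by (intro card_mono) auto
  finally have "card A + card B \<le> n"
    by simp
  moreover have "6 * num_cycles n \<alpha> \<le> 2 * n + card A"
    unfolding A_def by (rule six_num_cycles_le[OF a fix_a])
  moreover have "6 * num_cycles n \<beta> \<le> 2 * n + card B"
    unfolding B_def by (rule six_num_cycles_le[OF b fix_b])
  moreover have "int n + 1 - 2 * int g = int (num_cycles n \<alpha>) + int (num_cycles n \<beta>)"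
    using genus unfolding has_genus_def \<beta>_def by blast
  \<comment> \<open>Six times the genus equation gives 6(n + 1 - 2g) \<le> 4n +
    \<open>card A + card B\<close> \<le> 5n.\<close>
  ultimately show ?thesis
    by simp
qed

lemma primitive_imp_semiprimitive: "primitive n \<alpha> \<Longrightarrow> semiprimitive n \<alpha>"
  unfolding primitive_def semiprimitive_def by blast

lemma finite_semiprimitive: "finite {(n, \<alpha>). semiprimitive n \<alpha> \<and> has_genus n \<alpha> g}"
proof (rule finite_subset)
  \<comment> \<open>\<open>12 * g\<close> weakens 12g - 6 to avoid subtraction on
    \<open>nat\<close>.\<close>
  show "{(n, \<alpha>). semiprimitive n \<alpha> \<and> has_genus n \<alpha> g} \<subseteq> (SIGMA n:{..12 * g}. {\<alpha>. \<alpha> permutes {1..n}})"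
    by (auto dest!: semiprimitive_genus_bound simp: has_genus_def)
  show "finite (SIGMA n:{..12 * g}. {\<alpha>. \<alpha> permutes {1..n}})"
    by (intro finite_SigmaI finite_permutations) auto
qed

theorem theorem5p9:
  fixes g :: nat
  shows "(\<forall>n \<alpha>. primitive n \<alpha> \<and> has_genus n \<alpha> g \<longrightarrow> int n \<le> 6 * (2 * int g - 1)) \<and>
         finite {(n, \<alpha>). semiprimitive n \<alpha> \<and> has_genus n \<alpha> g} \<and>
         finite {(n, \<alpha>). primitive n \<alpha> \<and> has_genus n \<alpha> g}"
proof (intro conjI allI impI)
  show "int n \<le> 6 * (2 * int g - 1)" if "primitive n \<alpha> \<and> has_genus n \<alpha> g" for n \<alpha>
    using that primitive_imp_semiprimitive semiprimitive_genus_bound by blast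
  show "finite {(n, \<alpha>). semiprimitive n \<alpha> \<and> has_genus n \<alpha> g}"
    by (rule finite_semiprimitive)
  then show "finite {(n, \<alpha>). primitive n \<alpha> \<and> has_genus n \<alpha> g}"
    by (rule rev_finite_subset) (auto intro: primitive_imp_semiprimitive)
qed

end
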